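(* Let $M$ be a second countable topological manifold. Then the group $\mathrm{Homeo}(M)$ of all homeomorphisms of $M$ is natural (as an abstract group).
   Context: Manifolds are finite-dimensional and Hausdorff. The group operation on $\mathrm{Homeo}(M)$ is composition. A group $(G,* )$ is called natural if there exists a metric $d$ on the set $G$ such that (i) all right translations $x \mapsto x*a$ ($a \in G$) are isometries of $(G,d)$, and (ii) every group structure $(G,\circ)$ on the same set $G$ for which all right translations $x \mapsto x \circ a$ are isometries of $(G,d)$ is isomorphic as a group to $(G,* )$. *)

theory Defs
  imports "HOL-Analysis.Analysis" "HOL-Algebra.Bij"
begin

definition isometry_of :: "'a set \<Rightarrow> ('a \<Rightarrow> 'a \<Rightarrow> real) \<Rightarrow> ('a \<Rightarrow> 'a) \<Rightarrow> bool" where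
  "isometry_of S d f \<longleftrightarrow>
     bij_betw f S S \<and> (\<forall>x\<in>S. \<forall>y\<in>S. d (f x) (f y) = d x y)"

definition right_translations_isometric :: "('a, 'b) monoid_scheme \<Rightarrow> ('a \<Rightarrow> 'a \<Rightarrow> real) \<Rightarrow> bool" where
  "right_translations_isometric G d \<longleftrightarrow>
     (\<forall>a\<in>carrier G. isometry_of (carrier G) d (\<lambda>x. x \<otimes>\<^bsub>G\<^esub> a))"

definition natural_group :: "('a, 'b) monoid_scheme \<Rightarrow> bool" where
  "natural_group G \<longleftrightarrow>
     group G \<and>
     (\<exists>d. Metric_space (carrier G) d \<and>
          right_translations_isometric G d \<and>
          (\<forall>H :: 'a monoid.
             group H \<and> carrier H = carrier G \<and> right_translations_isometric H d \<longrightarrow> H \<cong> G))"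

text \<open>Manifolds have no boundary, the dimension may vary from point to point
  (hence between components), and dimension 0 as well as the empty space are allowed.
  \<^const>\<open>Euclidean_space\<close> \<open>n\<close> consists of the real sequences that vanish from index \<open>n\<close> on,
  with the product topology.\<close>

definition topological_manifold :: "'a topology \<Rightarrow> bool" where
  "topological_manifold X \<longleftrightarrow>
     Hausdorff_space X \<and>
     (\<forall>x\<in>topspace X. \<exists>n U V.
        openin X U \<and> x \<in> U \<and> openin (Euclidean_space n) V \<and>
        subtopology X U homeomorphic_space subtopology (Euclidean_space n) V)"

text \<open>A self-homeomorphism of \<open>X\<close> is represented by its unique extension that is
  \<^const>\<open>undefined\<close> outside \<^term>\<open>topspace X\<close>, as in \<^const>\<open>BijGroup\<close>.\<close>

definition Homeo :: "'a topology \<Rightarrow> ('a \<Rightarrow> 'a) monoid" where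
  "Homeo X = (BijGroup (topspace X))
     \<lparr>carrier := {f \<in> extensional (topspace X). homeomorphic_map X X f}\<rparr>"

lemma carrier_Homeo:
  "carrier (Homeo X) = {f \<in> extensional (topspace X). homeomorphic_map X X f}"
  by (simp add: Homeo_def)

lemma one_Homeo: "\<one>\<^bsub>Homeo X\<^esub> = (\<lambda>x\<in>topspace X. x)"
  by (simp add: Homeo_def BijGroup_def)

lemma carrier_Homeo_subset_Bij: "carrier (Homeo X) \<subseteq> Bij (topspace X)"
  using homeomorphic_imp_surjective_map homeomorphic_imp_injective_map
  by (fastforce simp: carrier_Homeo Bij_def bij_betw_def)

lemma mult_Homeo:
  assumes "f \<in> carrier (Homeo X)" "g \<in> carrier (Homeo X)"
  shows "f \<otimes>\<^bsub>Homeo X\<^esub> g = compose (topspace X) f g"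
  using assms carrier_Homeo_subset_Bij[of X] by (auto simp: Homeo_def BijGroup_def)

lemma group_Homeo: "group (Homeo X)"
proof (rule groupI)
  fix f g assume fg: "f \<in> carrier (Homeo X)" "g \<in> carrier (Homeo X)"
  then have "homeomorphic_map X X (f \<circ> g)"
    by (auto simp: carrier_Homeo intro: homeomorphic_map_compose)
  then have "homeomorphic_map X X (compose (topspace X) f g)"
    by (rule homeomorphic_map_eq) (simp add: compose_def)
  with fg show "f \<otimes>\<^bsub>Homeo X\<^esub> g \<in> carrier (Homeo X)"
    by (simp add: mult_Homeo) (simp add: carrier_Homeo)
next
  have "homeomorphic_map X X (\<lambda>x\<in>topspace X. x)"
    by (rule homeomorphic_map_eq[of X X id]) auto
  then show "\<one>\<^bsub>Homeo X\<^esub> \<in> carrier (Homeo X)"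
    by (simp add: one_Homeo carrier_Homeo)
next
  fix f g h
  assume "f \<in> carrier (Homeo X)" "g \<in> carrier (Homeo X)" "h \<in> carrier (Homeo X)"
  then have "f \<in> Bij (topspace X)" "g \<in> Bij (topspace X)" "h \<in> Bij (topspace X)"
    using carrier_Homeo_subset_Bij by blast+
  then show "f \<otimes>\<^bsub>Homeo X\<^esub> g \<otimes>\<^bsub>Homeo X\<^esub> h = f \<otimes>\<^bsub>Homeo X\<^esub> (g \<otimes>\<^bsub>Homeo X\<^esub> h)"
    using group.is_monoid[OF group_BijGroup[of "topspace X"]]
    by (auto simp: Homeo_def BijGroup_def monoid_def)
next
  fix f assume "f \<in> carrier (Homeo X)"
  then have "f \<in> Bij (topspace X)" using carrier_Homeo_subset_Bij by blast
  then show "\<one>\<^bsub>Homeo X\<^esub> \<otimes>\<^bsub>Homeo X\<^esub> f = f"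
    using group.is_monoid[OF group_BijGroup[of "topspace X"]]
    by (auto simp: Homeo_def BijGroup_def monoid_def)
next
  fix f assume f: "f \<in> carrier (Homeo X)"
  then have fB: "f \<in> Bij (topspace X)" using carrier_Homeo_subset_Bij by blast
  define g where "g = restrict (inv_into (topspace X) f) (topspace X)"
  from f obtain h where h: "homeomorphic_maps X X f h"
    by (auto simp: carrier_Homeo homeomorphic_map_maps)
  then have hX: "homeomorphic_map X X h"
    by (meson homeomorphic_map_maps homeomorphic_maps_sym)
  have "h y = g y" if "y \<in> topspace X" for y
  proof -
    have "f (h y) = y" "h y \<in> topspace X"
      using h hX that homeomorphic_imp_surjective_map[OF hX]
      by (auto simp: homeomorphic_maps_def)
    moreover have "inj_on f (topspace X)"
      using fB by (simp add: Bij_def bij_betw_def)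
    ultimately show ?thesis
      using that by (metis g_def inv_into_f_f restrict_apply')
  qed
  then have "homeomorphic_map X X g"
    using homeomorphic_map_eq[OF hX] by blast
  then have g: "g \<in> carrier (Homeo X)"
    by (simp add: carrier_Homeo g_def)
  moreover have "g \<otimes>\<^bsub>Homeo X\<^esub> f = \<one>\<^bsub>Homeo X\<^esub>"
    using g f Bij_compose_restrict_eq[OF fB] by (simp add: mult_Homeo one_Homeo g_def)
  ultimately show "\<exists>g\<in>carrier (Homeo X). g \<otimes>\<^bsub>Homeo X\<^esub> f = \<one>\<^bsub>Homeo X\<^esub>" by blast
qed

end

theory Submission
  imports Defs
begin

text \<open>The set \<open>Homeo M\<close> has at most the cardinality of the continuum, because a homeomorphism of a
  second countable Hausdorff space is determined by which basic open sets it maps into which.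
  Every group \<open>G\<close> of that size carries a right-invariant metric in which the distance between \<open>x\<close> and \<open>y\<close> determines the quotient \<open>x y\<inverse>\<close> up to inversion: take
  an injection of \<open>G\<close> into \<open>[0,1)\<close>, assign to each element the smaller of its own value and
  that of its inverse, and add 1 off the diagonal. All nonzero distances then lie in \<open>[1,2)\<close>, so
  the triangle inequality is automatic.

  An isometry \<open>f\<close> fixing the unit sends each element to itself or its inverse. If it inverts some
  \<open>x\<close> with \<open>x\<^sup>2 \<noteq> 1\<close>, comparing the distance from \<open>x\<close> to \<open>y\<close> with its image shows that
  every \<open>y\<close> commutes with \<open>x\<close>, or is inverted by conjugation by \<open>x\<close>, or satisfies
  \<open>y\<^sup>2 = x\<^sup>2\<close>. A group in which each \<open>x\<close> with \<open>x\<^sup>2 \<noteq> 1\<close> has a \<open>y\<close> violating all three therefore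
  has no isometries for this metric but its own right translations, and any group structure whose right
  translations are isometries must be a copy of \<open>G\<close>
  (\<open>natural_group_if_separated\<close>).

  Homeomorphism groups of manifolds have such a \<open>y\<close>. If \<open>f\<^sup>2 \<noteq> id\<close>, there is \<open>p\<close> such that
  \<open>p\<close>, \<open>q = f p\<close> and \<open>r = f q\<close> are distinct. When \<open>q\<close> is not isolated, let \<open>y\<close> be a nontrivial
  homeomorphism supported in a small neighbourhood \<open>W\<close> of \<open>q\<close>. Its conjugate by \<open>f\<close> is
  supported in \<open>f W\<close>, which is disjoint from \<open>W\<close>, and so is neither \<open>y\<close> nor \<open>y\<inverse>\<close>; moreover
  \<open>y\<^sup>2\<close> fixes \<open>p\<close> while \<open>f\<^sup>2\<close> does not. When \<open>q\<close> is isolated, then so is \<open>p\<close>, and the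
  transposition of \<open>p\<close> and \<open>q\<close> serves: its square is the identity, and its conjugate is the
  transposition of \<open>q\<close> and \<open>r\<close> (\<open>Homeo_separated\<close>).\<close>

section \<open>Rigid right-invariant metrics\<close>

text \<open>A right-invariant distance depends only on the quotient \<open>x y\<inverse>\<close>, and by symmetry it
  cannot tell this quotient from its inverse. The metric below tells apart everything else,
  so its isometry group is as small as possible among right-invariant metrics.\<close>

lemma (in group) right_invariant_metric_separating_quotients:
  assumes "carrier G \<lesssim> (UNIV :: real set)"
  obtains d where "Metric_space (carrier G) d" "right_translations_isometric G d"
    and "\<And>w x y z. \<lbrakk>w \<in> carrier G; x \<in> carrier G; y \<in> carrier G; z \<in> carrier G; d w x = d y z\<rbrakk>
           \<Longrightarrow> w \<otimes> inv x = y \<otimes> inv z \<or> w \<otimes> inv x = z \<otimes> inv y"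
proof -
  have "carrier G \<lesssim> {0..<1::real}"
    using assms nat_sets_eqpoll_reals nat_sets_lepoll_reals01
    by (meson eqpoll_imp_lepoll eqpoll_sym lepoll_trans)
  then obtain c :: "'a \<Rightarrow> real" where c: "inj_on c (carrier G)" "c \<in> carrier G \<rightarrow> {0..<1}"
    by (auto simp: lepoll_def)
  \<comment> \<open>The smaller of the two values identifies an element up to inversion: if two such minima
    agree, then some value at one of the pairs equals a value at the other.\<close>
  define m where "m = (\<lambda>x. min (c x) (c (inv x)))"
  define d where "d = (\<lambda>x y. if x = y then 0 else 1 + (if x \<in> carrier G \<and> y \<in> carrier G then m (x \<otimes> inv y) else 0))"
  have m_inv: "m (inv x) = m x" if "x \<in> carrier G" for x
    using that by (simp add: m_def min.commute)
  have m_bd: "0 \<le> m x" "m x < 1" if "x \<in> carrier G" for x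
    using c(2) that by (auto simp: m_def Pi_iff min_less_iff_disj)
  have quot_inv: "inv (x \<otimes> inv y) = y \<otimes> inv x" if "x \<in> carrier G" "y \<in> carrier G" for x y
    using that by (simp add: inv_mult_group)
  have m_eq: "x = y \<or> x = inv y" if "m x = m y" "x \<in> carrier G" "y \<in> carrier G" for x y
  proof -
    have "c x = c y \<or> c x = c (inv y) \<or> c (inv x) = c y \<or> c (inv x) = c (inv y)"
      using that(1) by (simp add: m_def min_def split: if_splits)
    then show ?thesis
      using that c(1) by (metis inj_onD inv_closed inv_inv)
  qed
  have one_iff: "x \<otimes> inv y = \<one> \<longleftrightarrow> x = y" if "x \<in> carrier G" "y \<in> carrier G" for x y
    using that by (metis inv_closed inv_equality inv_inv r_inv)
  have d_bd: "1 \<le> d x y \<and> d x y < 2" if "x \<in> carrier G" "y \<in> carrier G" "x \<noteq> y" for x y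
    using that m_bd[of "x \<otimes> inv y"] by (simp add: d_def)
  have sym: "d x y = d y x" for x y
    using m_inv[of "x \<otimes> inv y"] by (auto simp: d_def quot_inv)
  show thesis
  proof
    show "Metric_space (carrier G) d"
    proof
      show "0 \<le> d x y" for x y
        using m_bd by (auto simp: d_def)
      show "d x y = d y x" for x y by (rule sym)
      show "d x y = 0 \<longleftrightarrow> x = y" if "x \<in> carrier G" "y \<in> carrier G" for x y
        using d_bd[OF that] by (auto simp: d_def)
      show "d x z \<le> d x y + d y z" if "x \<in> carrier G" "y \<in> carrier G" "z \<in> carrier G" for x y z
      proof (cases "x = y \<or> y = z")
        case True
        then show ?thesis by (auto simp: d_def)
      next
        case False
        have "d x z \<le> 2"
          using d_bd[of x z] that by (cases "x = z") (auto simp: d_def)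
        with False d_bd[of x y] d_bd[of y z] that show ?thesis by fastforce
      qed
    qed
    show "right_translations_isometric G d"
      unfolding right_translations_isometric_def isometry_of_def
    proof (intro ballI conjI)
      fix a assume a: "a \<in> carrier G"
      show "bij_betw (\<lambda>x. x \<otimes> a) (carrier G) (carrier G)"
        by (rule bij_betw_byWitness[where f' = "\<lambda>x. x \<otimes> inv a"]) (use a in \<open>auto simp: m_assoc\<close>)
      fix x y assume xy: "x \<in> carrier G" "y \<in> carrier G"
      have "x \<otimes> a \<otimes> inv (y \<otimes> a) = x \<otimes> inv y"
        using a xy by (simp add: inv_mult_group m_assoc) (simp flip: m_assoc)
      with a xy show "d (x \<otimes> a) (y \<otimes> a) = d x y" by (simp add: d_def)
    qed
    fix w x y z
    assume mem: "w \<in> carrier G" "x \<in> carrier G" "y \<in> carrier G" "z \<in> carrier G"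
      and eq: "d w x = d y z"
    show "w \<otimes> inv x = y \<otimes> inv z \<or> w \<otimes> inv x = z \<otimes> inv y"
    proof (cases "w = x")
      case True
      with eq d_bd[of y z] mem have "y = z" by (fastforce simp: d_def)
      with True mem show ?thesis by simp
    next
      case False
      with eq d_bd[of w x] mem have "y \<noteq> z" by (auto simp: d_def)
      with False eq mem have "m (w \<otimes> inv x) = m (y \<otimes> inv z)" by (simp add: d_def)
      from m_eq[OF this] mem show ?thesis by (simp add: quot_inv)
    qed
  qed
qed

text \<open>If \<open>f\<close> moves \<open>x\<close>, then \<open>f x = x\<inverse> \<noteq> x\<close>. Let \<open>y\<close> be the element separated from \<open>x\<close>.
  The image of the quotient \<open>x y\<inverse>\<close> is \<open>x\<inverse> y\<inverse>\<close> or \<open>x\<inverse> y\<close>, depending on \<open>f y\<close>, and must be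
  \<open>x y\<inverse>\<close> or \<open>y x\<inverse>\<close>. The four equations say, in turn, that \<open>x = x\<inverse>\<close>, that conjugation by \<open>x\<close>
  inverts \<open>y\<close>, that \<open>y\<^sup>2 = x\<^sup>2\<close>, and that \<open>x\<close> and \<open>y\<close> commute. The second alternative is written
  \<open>y x y = x\<close> in the hypothesis, which spares computing inverses in a concrete group.\<close>

lemma (in group) quotients_up_to_inversion_rigid:
  assumes sep: "\<And>x. \<lbrakk>x \<in> carrier G; x \<otimes> x \<noteq> \<one>\<rbrakk> \<Longrightarrow>
      \<exists>y\<in>carrier G. x \<otimes> y \<noteq> y \<otimes> x \<and> y \<otimes> (x \<otimes> y) \<noteq> x \<and> y \<otimes> y \<noteq> x \<otimes> x"
    and f: "f \<in> carrier G \<rightarrow> carrier G" "f \<one> = \<one>"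
    and quot: "\<And>x y. \<lbrakk>x \<in> carrier G; y \<in> carrier G\<rbrakk> \<Longrightarrow>
      f x \<otimes> inv (f y) = x \<otimes> inv y \<or> f x \<otimes> inv (f y) = y \<otimes> inv x"
    and x: "x \<in> carrier G"
  shows "f x = x"
proof (rule ccontr)
  assume ne: "f x \<noteq> x"
  have val: "f y = y \<or> f y = inv y" if "y \<in> carrier G" for y
    using quot[OF that one_closed] that f by (auto simp: Pi_iff)
  with ne x have fx: "f x = inv x" by blast
  with ne x have "x \<otimes> x \<noteq> \<one>" by (metis inv_equality)
  with sep x obtain y where y: "y \<in> carrier G"
    and comm: "x \<otimes> y \<noteq> y \<otimes> x" and invd: "y \<otimes> (x \<otimes> y) \<noteq> x" and sq: "y \<otimes> y \<noteq> x \<otimes> x"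
    by blast
  consider "inv x \<otimes> inv y = x \<otimes> inv y" | "inv x \<otimes> inv y = y \<otimes> inv x"
    | "inv x \<otimes> y = x \<otimes> inv y" | "inv x \<otimes> y = y \<otimes> inv x"
    using quot[OF x y] val[OF y] fx x y by auto
  then show False
  proof cases
    case 1
    with x y have "inv x = x" by simp
    with fx ne show False by simp
  next
    case 2
    then have "y \<otimes> inv x \<otimes> x = inv x \<otimes> inv y \<otimes> x" by simp
    with x y have "y = inv x \<otimes> inv y \<otimes> x" by (simp add: m_assoc)
    then have "y \<otimes> (x \<otimes> y) = y \<otimes> (x \<otimes> (inv x \<otimes> inv y \<otimes> x))" by simp
    also have "\<dots> = x"
      using x y by (simp add: m_assoc) (simp flip: m_assoc)
    finally show False using invd by simp
  next
    case 3
    then have "x \<otimes> (inv x \<otimes> y) \<otimes> y = x \<otimes> (x \<otimes> inv y) \<otimes> y" by simp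
    with x y have "y \<otimes> y = x \<otimes> x"
      by (metis inv_closed inv_solve_right m_assoc m_closed r_inv l_one)
    with sq show False by simp
  next
    case 4
    then have "x \<otimes> (inv x \<otimes> y) \<otimes> x = x \<otimes> (y \<otimes> inv x) \<otimes> x" by simp
    with x y have "y \<otimes> x = x \<otimes> y" 
      by (metis inv_closed inv_solve_right m_assoc m_closed r_inv l_one)
    with comm show False by simp
  qed
qed

text \<open>Composing an isometry \<open>T\<close> with a right translation makes it fix the unit, so by rigidity
  \<open>T\<close> is right multiplication by \<open>T \<one>\<close>. For a second group \<open>H\<close> on the same set this identifies
  its right translation by \<open>a\<close> with right multiplication in \<open>G\<close> by \<open>\<phi> a\<close>, the \<open>H\<close>-product of the
  unit of \<open>G\<close> with \<open>a\<close>; associativity in \<open>H\<close> makes \<open>\<phi>\<close> a homomorphism.\<close>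

lemma (in group) natural_group_if_separated:
  assumes card: "carrier G \<lesssim> (UNIV :: real set)"
    and sep: "\<And>x. \<lbrakk>x \<in> carrier G; x \<otimes> x \<noteq> \<one>\<rbrakk> \<Longrightarrow>
      \<exists>y\<in>carrier G. x \<otimes> y \<noteq> y \<otimes> x \<and> y \<otimes> (x \<otimes> y) \<noteq> x \<and> y \<otimes> y \<noteq> x \<otimes> x"
  shows "natural_group G"
proof -
  obtain d where d: "Metric_space (carrier G) d" "right_translations_isometric G d"
    and quot: "\<And>w x y z. \<lbrakk>w \<in> carrier G; x \<in> carrier G; y \<in> carrier G; z \<in> carrier G; d w x = d y z\<rbrakk>
           \<Longrightarrow> w \<otimes> inv x = y \<otimes> inv z \<or> w \<otimes> inv x = z \<otimes> inv y"
    using right_invariant_metric_separating_quotients[OF card] by blast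
  have translation: "T x = x \<otimes> T \<one>"
    if T: "isometry_of (carrier G) d T" and x: "x \<in> carrier G" for T x
  proof -
    have cl: "T y \<in> carrier G" if "y \<in> carrier G" for y
      using T that by (auto simp: isometry_of_def bij_betw_def)
    have "T x \<otimes> inv (T \<one>) = x"
    proof (rule quotients_up_to_inversion_rigid[OF sep])
      fix y z assume yz: "y \<in> carrier G" "z \<in> carrier G"
      have "d (T y) (T z) = d y z" using T yz by (simp add: isometry_of_def)
      moreover have "T y \<otimes> inv (T \<one>) \<otimes> inv (T z \<otimes> inv (T \<one>)) = T y \<otimes> inv (T z)"
        using cl yz by (simp add: inv_mult_group m_assoc) (simp flip: m_assoc)
      ultimately show "T y \<otimes> inv (T \<one>) \<otimes> inv (T z \<otimes> inv (T \<one>)) = y \<otimes> inv z \<or>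
          T y \<otimes> inv (T \<one>) \<otimes> inv (T z \<otimes> inv (T \<one>)) = z \<otimes> inv y"
        using quot cl yz by simp
    qed (use cl x in auto)
    then show ?thesis using cl x by (metis inv_solve_right' one_closed)
  qed
  have "H \<cong> G"
    if H: "group H" "carrier H = carrier G" "right_translations_isometric H d" for H :: "'a monoid"
  proof -
    interpret H: group H by fact
    define \<phi> where "\<phi> = (\<lambda>a. \<one> \<otimes>\<^bsub>H\<^esub> a)"
    have 1: "\<one> \<in> carrier H" using H(2) by simp
    have "\<phi> (a \<otimes>\<^bsub>H\<^esub> b) = \<phi> a \<otimes> \<phi> b" if "a \<in> carrier H" "b \<in> carrier H" for a b
    proof -
      have "isometry_of (carrier G) d (\<lambda>x. x \<otimes>\<^bsub>H\<^esub> b)"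
        using H that by (simp add: right_translations_isometric_def)
      from translation[OF this, of "\<phi> a"] that 1 H(2) show ?thesis
        by (metis H.m_assoc H.m_closed \<phi>_def)
    qed
    moreover have "bij_betw \<phi> (carrier H) (carrier H)"
      unfolding \<phi>_def
      by (rule bij_betw_byWitness[where f' = "\<lambda>a. inv\<^bsub>H\<^esub> \<one> \<otimes>\<^bsub>H\<^esub> a"])
        (use 1 in \<open>auto simp flip: H.m_assoc\<close>)
    ultimately have "\<phi> \<in> iso H G"
      using H(2) by (auto simp: iso_def hom_def bij_betw_def)
    then show ?thesis by (auto simp: is_iso_def)
  qed
  with d show ?thesis
    unfolding natural_group_def using is_group by blast
qed

section \<open>The cardinality of the homeomorphism group\<close>

text \<open>With countable bases \<open>\<B>\<close> and \<open>\<C>\<close>, a continuous map is determined by the set of pairs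
  \<open>(B, C)\<close> with \<open>f ` B \<subseteq> C\<close>: if \<open>f x \<noteq> g x\<close>, some basic \<open>C\<close> around \<open>f x\<close> avoids \<open>g x\<close>, and by
  continuity \<open>f\<close> maps a basic neighbourhood of \<open>x\<close> into \<open>C\<close>, while \<open>g\<close> does not.\<close>

lemma continuous_maps_second_countable_Hausdorff_lepoll_real:
  assumes X: "second_countable X" and Y: "second_countable Y" "Hausdorff_space Y"
  shows "{f \<in> extensional (topspace X). continuous_map X Y f} \<lesssim> (UNIV :: real set)"
proof -
  obtain \<B> where \<B>: "countable \<B>" "\<And>U x. openin X U \<Longrightarrow> x \<in> U \<Longrightarrow> \<exists>B\<in>\<B>. x \<in> B \<and> B \<subseteq> U"
    using X unfolding second_countable_def by meson
  obtain \<C> where \<C>: "countable \<C>" "\<And>V. V \<in> \<C> \<Longrightarrow> openin Y V"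
      "\<And>U x. openin Y U \<Longrightarrow> x \<in> U \<Longrightarrow> \<exists>B\<in>\<C>. x \<in> B \<and> B \<subseteq> U"
    using Y(1) unfolding second_countable_def by meson
  define F where "F = (\<lambda>f. {(B, C) \<in> \<B> \<times> \<C>. f ` B \<subseteq> C})"
  have "inj_on F {f \<in> extensional (topspace X). continuous_map X Y f}"
  proof (rule inj_onI, clarify)
    fix f g assume f: "f \<in> extensional (topspace X)" "continuous_map X Y f"
      and g: "g \<in> extensional (topspace X)" "continuous_map X Y g" and eq: "F f = F g"
    show "f = g"
    proof (rule extensionalityI[OF f(1) g(1)], rule ccontr)
      fix x assume x: "x \<in> topspace X" and ne: "f x \<noteq> g x"
      have "f x \<in> topspace Y" "g x \<in> topspace Y"
        using x f g by (auto simp: continuous_map_def)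
      with ne Y(2) obtain V V' where V: "openin Y V" "f x \<in> V" "g x \<in> V'" "disjnt V V'"
        unfolding Hausdorff_space_def by metis
      obtain C where C: "C \<in> \<C>" "f x \<in> C" "C \<subseteq> V" using \<C>(3) V(1,2) by blast
      have "openin X {z \<in> topspace X. f z \<in> C}"
        using C(1) \<C>(2) f(2) openin_continuous_map_preimage by blast
      from \<B>(2)[OF this, of x] x C(2) obtain B where "B \<in> \<B>" "x \<in> B" "B \<subseteq> {z \<in> topspace X. f z \<in> C}"
        by blast
      then have B: "B \<in> \<B>" "x \<in> B" "f ` B \<subseteq> C" by auto
      then have "(B, C) \<in> F f" using C(1) by (auto simp: F_def)
      then have "(B, C) \<in> F g" using eq by simp
      then have "g x \<in> C" using B(2) by (auto simp: F_def)
      with C(3) V(3,4) show False by (auto simp: disjnt_iff)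
    qed
  qed
  then have "{f \<in> extensional (topspace X). continuous_map X Y f} \<lesssim> Pow (\<B> \<times> \<C>)"
    unfolding lepoll_def by (intro exI[of _ F]) (auto simp: F_def)
  also have "Pow (\<B> \<times> \<C>) \<lesssim> (UNIV :: nat set set)"
  proof -
    have "countable (\<B> \<times> \<C>)" using \<B>(1) \<C>(1) by blast
    then obtain e :: "_ \<Rightarrow> nat" where "inj_on e (\<B> \<times> \<C>)" by (auto simp: countable_def)
    then show ?thesis
      unfolding lepoll_def by (intro exI[of _ "image e"]) (auto intro: inj_on_image_Pow)
  qed
  also have "(UNIV :: nat set set) \<lesssim> (UNIV :: real set)"
    by (rule eqpoll_imp_lepoll[OF nat_sets_eqpoll_reals])
  finally show ?thesis .
qed

section \<open>Compactly supported homeomorphisms\<close>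

text \<open>In a Hausdorff space the compact set \<open>C\<close> is closed, so the extensions of \<open>f\<close> and of its
  inverse are pasted from maps on the open sets \<open>U\<close> and \<open>topspace X - C\<close>, which cover the space.\<close>

lemma homeomorphic_map_extend_by_identity:
  assumes X: "Hausdorff_space X" and U: "openin X U" and C: "compactin X C" "C \<subseteq> U"
    and fg: "homeomorphic_maps (subtopology X U) (subtopology X U) f g"
    and f: "\<And>x. x \<in> U - C \<Longrightarrow> f x = x"
  shows "homeomorphic_map X X (\<lambda>x. if x \<in> U then f x else x)"
proof -
  have UX: "U \<subseteq> topspace X" using U by (rule openin_subset)
  have ext: "continuous_map X X (\<lambda>x. if x \<in> U then k x else x)"
    if k: "continuous_map (subtopology X U) (subtopology X U) k" "\<And>x. x \<in> U - C \<Longrightarrow> k x = x" for k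
  proof (rule pasting_lemma[where I = "UNIV :: bool set"
        and T = "\<lambda>b. if b then U else topspace X - C" and f = "\<lambda>b. if b then k else (\<lambda>x. x)"])
    show "openin X (if i then U else topspace X - C)" for i
      using U compactin_imp_closedin[OF X C(1)] by auto
    show "continuous_map (subtopology X (if i then U else topspace X - C)) X (if i then k else (\<lambda>x. x))" for i
      using k(1) continuous_map_from_subtopology[OF continuous_map_id, of X]
      by (auto simp: continuous_map_in_subtopology id_def)
    show "(if i then k else (\<lambda>x. x)) x = (if j then k else (\<lambda>x. x)) x"
      if "x \<in> topspace X \<inter> (if i then U else topspace X - C) \<inter> (if j then U else topspace X - C)"
      for i j x
      using that k(2) by (auto split: if_splits)
    show "\<exists>j. j \<in> UNIV \<and> x \<in> (if j then U else topspace X - C) \<and>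
        (if x \<in> U then k x else x) = (if j then k else (\<lambda>x. x)) x" if "x \<in> topspace X" for x
      using that C(2) by (cases "x \<in> U") (auto intro: exI[of _ True] exI[of _ False])
  qed
  have fg': "f x \<in> U" "g x \<in> U" "g (f x) = x" "f (g x) = x" if "x \<in> U" for x
    using fg that UX by (auto simp: homeomorphic_maps_def continuous_map_def Pi_iff)
  have g: "g x = x" if "x \<in> U - C" for x
    using f[OF that] fg'(3)[of x] that by auto
  have "homeomorphic_maps X X (\<lambda>x. if x \<in> U then f x else x) (\<lambda>x. if x \<in> U then g x else x)"
    using fg ext[of f] ext[of g] f g fg' by (auto simp: homeomorphic_maps_def)
  then show ?thesis by (rule homeomorphic_maps_imp_map)
qed

text \<open>The set \<open>{p, q}\<close> is at once open, compact and discrete, so extension by the identity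
  applies with \<open>U = C = {p, q}\<close>.\<close>

lemma homeomorphic_map_swap_isolated_points:
  assumes X: "Hausdorff_space X" and "openin X {p}" "openin X {q}"
  shows "homeomorphic_map X X (\<lambda>x. if x = p then q else if x = q then p else x)"
proof -
  let ?s = "\<lambda>x. if x = p then q else p"
  have U: "openin X {p, q}" using openin_Un[OF assms(2,3)] by (simp add: insert_commute)
  have pq: "p \<in> topspace X" "q \<in> topspace X" using assms(2,3) openin_subset by blast+
  have disc: "subtopology X {p, q} = discrete_topology {p, q}"
  proof (rule sym, subst discrete_topology_unique, intro conjI ballI)
    show "topspace (subtopology X {p, q}) = {p, q}" using pq by auto
    show "openin (subtopology X {p, q}) {x}" if "x \<in> {p, q}" for x
      using that assms(2,3) by (auto simp: openin_subtopology_alt)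
  qed
  have "homeomorphic_map X X (\<lambda>x. if x \<in> {p, q} then ?s x else x)"
  proof (rule homeomorphic_map_extend_by_identity[OF X U])
    show "compactin X {p, q}" using pq by (simp add: finite_imp_compactin)
    show "homeomorphic_maps (subtopology X {p, q}) (subtopology X {p, q}) ?s ?s"
      unfolding disc homeomorphic_maps_def by auto
  qed auto
  then show ?thesis by (rule homeomorphic_map_eq) auto
qed

definition l1_norm :: "nat \<Rightarrow> (nat \<Rightarrow> real) \<Rightarrow> real" where
  "l1_norm n u = (\<Sum>i<n. \<bar>u i\<bar>)"

lemma l1_norm_nonneg: "0 \<le> l1_norm n u"
  by (simp add: l1_norm_def sum_nonneg)

lemma abs_le_l1_norm: "i < n \<Longrightarrow> \<bar>u i\<bar> \<le> l1_norm n u"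
  unfolding l1_norm_def by (rule member_le_sum) auto

lemma l1_norm_scale: "l1_norm n (\<lambda>i. a * u i) = \<bar>a\<bar> * l1_norm n u"
  by (simp add: l1_norm_def sum_distrib_left abs_mult)

lemma Euclidean_space_eq_top_of_set: "Euclidean_space n = top_of_set {x. \<forall>i\<ge>n. x i = 0}"
  by (simp add: Euclidean_space_def euclidean_product_topology)

text \<open>The ball is a closed subset of a product of compact intervals and points, so
  Tychonoff's theorem gives compactness.\<close>

lemma compactin_Euclidean_space_l1_cball:
  "compactin (Euclidean_space n) {x \<in> topspace (Euclidean_space n). l1_norm n (\<lambda>i. x i - v i) \<le> \<delta>}"
    (is "compactin _ ?K")
proof -
  let ?B = "PiE UNIV (\<lambda>i. if i < n then cball (v i) \<delta> else {0})"
  let ?D = "{x. l1_norm n (\<lambda>i. x i - v i) \<le> \<delta>}"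
  have "compactin (powertop_real UNIV) ?B" by (simp add: compactin_PiE)
  then have "compact ?B" by (simp add: euclidean_product_topology)
  moreover have "closed ?D"
    unfolding l1_norm_def
    by (intro closed_Collect_le continuous_intros continuous_on_product_coordinates)
  ultimately have "compact (?B \<inter> ?D)" by (rule compact_Int_closed)
  moreover have K: "?K = ?B \<inter> ?D"
  proof (rule Set.set_eqI, rule iffI)
    fix x assume x: "x \<in> ?K"
    have "\<bar>x i - v i\<bar> \<le> \<delta>" if "i < n" for i
      using abs_le_l1_norm[OF that, of "\<lambda>i. x i - v i"] x by simp
    with x show "x \<in> ?B \<inter> ?D"
      by (auto simp: topspace_Euclidean_space dist_real_def abs_minus_commute)
  next
    fix x assume x: "x \<in> ?B \<inter> ?D"
    have "x i = 0" if "i \<ge> n" for i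
      using PiE_mem[of x UNIV "\<lambda>i. if i < n then cball (v i) \<delta> else {0}" i] x that by auto
    with x show "x \<in> ?K" by (auto simp: topspace_Euclidean_space)
  qed
  ultimately show ?thesis
    unfolding K[symmetric]
    by (auto simp: Euclidean_space_eq_top_of_set compactin_subtopology)
qed

lemma Euclidean_space_l1_cball_subset:
  assumes V: "openin (Euclidean_space n) V" and v: "v \<in> V"
  obtains \<delta> where "\<delta> > 0"
    "{x \<in> topspace (Euclidean_space n). l1_norm n (\<lambda>i. x i - v i) \<le> \<delta>} \<subseteq> V"
proof -
  have v0: "v i = 0" if "i \<ge> n" for i
    using openin_subset[OF V] v that by (auto simp: topspace_Euclidean_space)
  obtain S where S: "openin (powertop_real UNIV) S" "V = S \<inter> {x. \<forall>i\<ge>n. x i = 0}"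
    using V by (auto simp: Euclidean_space_def openin_subtopology)
  obtain X where X: "v \<in> PiE UNIV X" "\<And>i. open (X i)" "PiE UNIV X \<subseteq> S"
    using product_topology_open_contains_basis[OF S(1), of v] v S(2) by auto
  then have "\<exists>e>0. cball (v i) e \<subseteq> X i" for i
    using open_contains_cball by (metis PiE_mem UNIV_I)
  then obtain e where e: "\<And>i. e i > 0" "\<And>i. cball (v i) (e i) \<subseteq> X i" by metis
  define \<delta> where "\<delta> = Min (insert 1 (e ` {..<n}))"
  have \<delta>: "\<delta> > 0" "\<And>i. i < n \<Longrightarrow> \<delta> \<le> e i" using e(1) by (auto simp: \<delta>_def)
  have "x \<in> V" if x: "\<forall>i\<ge>n. x i = 0" and le: "l1_norm n (\<lambda>i. x i - v i) \<le> \<delta>" for x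
  proof -
    have "x i \<in> X i" for i
    proof (cases "i < n")
      case True
      then have "\<bar>x i - v i\<bar> \<le> e i"
        using abs_le_l1_norm[OF True, of "\<lambda>i. x i - v i"] le \<delta>(2)[OF True] by linarith
      then show ?thesis using e(2)[of i] by (auto simp: dist_real_def abs_minus_commute)
    next
      case False
      then show ?thesis using x v0[of i] X(1) by (metis PiE_mem UNIV_I linorder_not_less)
    qed
    then show ?thesis using X(3) x S(2) by (auto simp: PiE_iff)
  qed
  with \<delta>(1) that show thesis by (auto simp: topspace_Euclidean_space)
qed

text \<open>A radial map about \<open>v\<close> does it: multiply the vector from \<open>v\<close> to \<open>x\<close> by \<open>a t\<close>, where \<open>t\<close> is
  the distance in units of \<open>\<delta>\<close>. With \<open>a t = 1 / (2 - t)\<close> on the unit interval, the radius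
  \<open>t\<close> becomes \<open>t / (2 - t)\<close>, an increasing bijection of \<open>[0,1]\<close> whose inverse
  \<open>t \<mapsto> 2 t / (1 + t)\<close> is again \<open>t\<close> times a factor that is continuous at 0. So both directions
  are visibly continuous at the centre. Positive dimension is needed to have a point at an
  intermediate radius, and only such points move.\<close>

lemma Euclidean_space_compactly_supported_homeomorphism:
  assumes n: "n > 0" and V: "openin (Euclidean_space n) V" and v: "v \<in> V"
  obtains h h' C where "homeomorphic_maps (Euclidean_space n) (Euclidean_space n) h h'"
    "compactin (Euclidean_space n) C" "C \<subseteq> V" "\<And>x. x \<in> topspace (Euclidean_space n) - C \<Longrightarrow> h x = x"
    "\<exists>x\<in>V. h x \<noteq> x"
proof -
  let ?E = "{x :: nat \<Rightarrow> real. \<forall>i\<ge>n. x i = 0}"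
  have vE: "v \<in> ?E" using openin_subset[OF V] v by (auto simp: topspace_Euclidean_space)
  obtain \<delta> where \<delta>: "\<delta> > 0" "{x \<in> ?E. l1_norm n (\<lambda>i. x i - v i) \<le> \<delta>} \<subseteq> V" (is "?K \<subseteq> V")
    using Euclidean_space_l1_cball_subset[OF V v] by (auto simp: topspace_Euclidean_space)
  define N where "N = (\<lambda>x. l1_norm n (\<lambda>i. x i - v i) / \<delta>)"
  define R where "R = (\<lambda>(g :: real \<Rightarrow> real) x i. v i + g (N x) * (x i - v i))"
  define a where "a = (\<lambda>t :: real. 1 / (2 - min t 1))"
  define b where "b = (\<lambda>t :: real. 2 / (1 + min t 1))"
  have R_apply: "R g x i = v i + g (N x) * (x i - v i)" for g x i by (simp add: R_def)
  have N0: "0 \<le> N x" for x using \<delta>(1) by (simp add: N_def l1_norm_nonneg)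
  have contN: "continuous_on S N" for S
    unfolding N_def l1_norm_def using \<delta>(1) by (intro continuous_intros continuous_on_subset[OF continuous_on_product_coordinates]) auto
  have contR: "continuous_map (Euclidean_space n) (Euclidean_space n) (R g)"
    if "continuous_on {0..} g" for g
  proof -
    have "continuous_on ?E (\<lambda>x. g (N x))"
      by (rule continuous_on_compose2[OF that contN]) (use N0 in auto)
    then have "continuous_on ?E (\<lambda>x. R g x i)" for i
      unfolding R_def by (intro continuous_intros continuous_on_subset[OF continuous_on_product_coordinates]) auto
    then have "continuous_on ?E (R g)"
      by (rule continuous_on_coordinatewise_then_product)
    moreover have "R g \<in> ?E \<rightarrow> ?E" using vE by (auto simp: R_def)
    ultimately show ?thesis by (simp add: Euclidean_space_eq_top_of_set)
  qed
  have N_R: "N (R g x) = \<bar>g (N x)\<bar> * N x" for g x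
    by (simp add: N_def R_def l1_norm_scale)
  have R_R: "R g (R k x) = x" if "\<And>t. t \<ge> 0 \<Longrightarrow> k t \<ge> 0 \<and> g (k t * t) * k t = 1" for g k x
  proof
    fix i
    have "g (N (R k x)) * k (N x) = 1"
      using that[OF N0[of x]] by (simp add: N_R)
    then have "g (N (R k x)) * (R k x i - v i) = x i - v i"
      by (simp add: R_apply[of k] flip: mult.assoc)
    then show "R g (R k x) i = x i" by (simp add: R_apply[of g])
  qed
  have ab: "(a t \<ge> 0 \<and> b (a t * t) * a t = 1) \<and> (b t \<ge> 0 \<and> a (b t * t) * b t = 1)" if "t \<ge> 0" for t
  proof (cases "t \<le> 1")
    case True
    with that have *: "t / (2 - t) \<le> 1" "2 * t / (1 + t) \<le> 1" "2 - t > 0" "1 + t > 0"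
      by (auto simp: divide_simps)
    have "2 / (1 + t / (2 - t)) = 2 - t" "1 / (2 - 2 * t / (1 + t)) = (1 + t) / 2"
      using * by (simp_all add: field_simps)
    with * True show ?thesis
      by (simp_all add: a_def b_def)
  qed (simp_all add: a_def b_def)
  have homeo: "homeomorphic_maps (Euclidean_space n) (Euclidean_space n) (R a) (R b)"
    unfolding homeomorphic_maps_def
  proof (intro conjI ballI)
    show "continuous_map (Euclidean_space n) (Euclidean_space n) (R a)"
      unfolding a_def by (intro contR continuous_intros) auto
    show "continuous_map (Euclidean_space n) (Euclidean_space n) (R b)"
      unfolding b_def by (intro contR continuous_intros) (auto simp: min_def)
  qed (use R_R ab in auto)
  have out: "R a x = x" if "x \<in> ?E - ?K" for x
  proof -
    have "\<not> l1_norm n (\<lambda>i. x i - v i) \<le> \<delta>" using that by blast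
    then have "N x > 1" using \<delta>(1) by (simp add: N_def)
    then show ?thesis by (simp add: R_def a_def)
  qed
  \<comment> \<open>A point at half the radius, which \<open>R a\<close> moves to a third of it.\<close>
  define w where "w = v(0 := v 0 + \<delta> / 2)"
  have Nw: "N w = 1/2"
  proof -
    have "l1_norm n (\<lambda>i. w i - v i) = (\<Sum>i<n. if i = 0 then \<delta> / 2 else 0)"
      unfolding l1_norm_def using \<delta>(1) by (intro sum.cong) (auto simp: w_def)
    with n \<delta>(1) show ?thesis by (simp add: N_def)
  qed
  have "w \<in> ?E" using vE n by (auto simp: w_def)
  moreover have "l1_norm n (\<lambda>i. w i - v i) \<le> \<delta>" using Nw \<delta>(1) by (simp add: N_def field_simps)
  ultimately have "w \<in> V" using \<delta>(2) by blast
  moreover have "R a w 0 \<noteq> w 0"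
  proof -
    have "w 0 = v 0 + \<delta> / 2" by (simp add: w_def)
    then show ?thesis using \<delta>(1) by (simp add: R_def Nw a_def)
  qed
  ultimately have "\<exists>x\<in>V. R a x \<noteq> x" by metis
  moreover have "compactin (Euclidean_space n) ?K"
    using compactin_Euclidean_space_l1_cball[of n v \<delta>] by (simp add: topspace_Euclidean_space)
  moreover have "R a x = x" if "x \<in> topspace (Euclidean_space n) - ?K" for x
    using out[of x] that by (auto simp: topspace_Euclidean_space)
  ultimately show thesis using that[OF homeo] \<delta>(2) by blast
qed

text \<open>Conjugate the Euclidean bump by a chart restricted to a neighbourhood contained in
  \<open>W\<close>, and extend by the identity. The chart has positive dimension because a point with a
  zero-dimensional chart is isolated.\<close>

lemma manifold_homeomorphism_supported_near_nonisolated_point: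
  assumes M: "topological_manifold M" and W: "openin M W" "q \<in> W" and q: "\<not> openin M {q}"
  obtains h where "homeomorphic_map M M h" "\<And>x. x \<in> topspace M - W \<Longrightarrow> h x = x" "\<exists>x\<in>W. h x \<noteq> x"
proof -
  have HM: "Hausdorff_space M" using M by (simp add: topological_manifold_def)
  have "q \<in> topspace M" using openin_subset[OF W(1)] W(2) by blast
  then obtain n U V where U: "openin M U" "q \<in> U" and V: "openin (Euclidean_space n) V"
    and UV: "subtopology M U homeomorphic_space subtopology (Euclidean_space n) V"
    using M unfolding topological_manifold_def by meson
  define U' where "U' = U \<inter> W"
  have U': "openin M U'" "q \<in> U'" "U' \<subseteq> U" "U' \<subseteq> W" using U W by (auto simp: U'_def)
  have UX: "U \<subseteq> topspace M" and VX: "V \<subseteq> topspace (Euclidean_space n)"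
    using U(1) V openin_subset by blast+
  obtain \<phi> \<psi> where \<phi>\<psi>: "homeomorphic_maps (subtopology M U) (subtopology (Euclidean_space n) V) \<phi> \<psi>"
    using UV by (auto simp: homeomorphic_space_def)
  define V' where "V' = \<phi> ` U'"
  have \<phi>UV: "\<phi> x \<in> V" if "x \<in> U" for x
    using \<phi>\<psi> that UX by (auto simp: homeomorphic_maps_def continuous_map_def Pi_iff)
  have sub: "homeomorphic_maps (subtopology M U') (subtopology (Euclidean_space n) V') \<phi> \<psi>"
  proof -
    have "\<phi> ` (topspace (subtopology M U) \<inter> U') = topspace (subtopology (Euclidean_space n) V) \<inter> V'"
      using \<phi>UV UX VX U'(3) unfolding V'_def topspace_subtopology by blast
    moreover have "V' \<subseteq> V" using \<phi>UV U'(3) by (auto simp: V'_def)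
    moreover have "subtopology (subtopology M U) U' = subtopology M U'"
      using U'(3) by (simp add: subtopology_subtopology Int_absorb1)
    ultimately show ?thesis
      using homeomorphic_maps_subtopologies[OF \<phi>\<psi>, of U' V']
      by (simp add: subtopology_subtopology Int_absorb1)
  qed
  have V': "openin (Euclidean_space n) V'"
  proof -
    have "openin (subtopology (Euclidean_space n) V) V'"
      unfolding V'_def
      using homeomorphic_imp_open_map[OF homeomorphic_maps_imp_map[OF \<phi>\<psi>]] U'(1,3)
      by (auto simp: open_map_def openin_open_subtopology[OF U(1)])
    then show ?thesis using openin_open_subtopology[OF V] by blast
  qed
  have \<psi>\<phi>: "\<psi> (\<phi> x) = x" if "x \<in> U'" for x
    using \<phi>\<psi> that U'(3) UX by (auto simp: homeomorphic_maps_def)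
  have "n > 0"
  proof (rule ccontr)
    assume "\<not> n > 0"
    then have "V \<subseteq> {\<lambda>i. 0}" using VX by (auto simp: topspace_Euclidean_space)
    then have "\<phi> x = \<phi> q" if "x \<in> U'" for x
      using \<phi>UV[of x] \<phi>UV[of q] that U(2) U'(3) by (metis singletonD subsetD)
    then have "x = q" if "x \<in> U'" for x
      using \<psi>\<phi>[OF that] \<psi>\<phi>[OF U'(2)] that by metis
    then have "U' = {q}" using U'(2) by blast
    with U'(1) q show False by simp
  qed
  have "\<phi> q \<in> V'" using U'(2) by (simp add: V'_def)
  from Euclidean_space_compactly_supported_homeomorphism[OF \<open>n > 0\<close> V' this]
  obtain h h' C where h: "homeomorphic_maps (Euclidean_space n) (Euclidean_space n) h h'"
    "compactin (Euclidean_space n) C" "C \<subseteq> V'" "\<And>x. x \<in> topspace (Euclidean_space n) - C \<Longrightarrow> h x = x"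
    "\<exists>x\<in>V'. h x \<noteq> x"
    by blast
  have hV: "homeomorphic_maps (subtopology (Euclidean_space n) V') (subtopology (Euclidean_space n) V') h h'"
  proof -
    let ?E = "topspace (Euclidean_space n)"
    have hE: "h x \<in> ?E" "h' x \<in> ?E" "h' (h x) = x" "h (h' x) = x" if "x \<in> ?E" for x
      using h(1) that by (auto simp: homeomorphic_maps_def continuous_map_def Pi_iff)
    have "h x \<in> V'" if "x \<in> ?E" "x \<in> V'" for x
      using h(3,4) hE that by (metis DiffI subsetD)
    moreover have "h' x \<in> V'" if "x \<in> ?E" "x \<in> V'" for x
      using h(3,4) hE that by (metis DiffI subsetD)
    ultimately show ?thesis
      by (intro homeomorphic_maps_subtopologies_alt[OF h(1)]) auto
  qed
  define y where "y = (\<lambda>x. if x \<in> U' then (\<psi> \<circ> (h \<circ> \<phi>)) x else x)"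
  have "homeomorphic_map M M y"
    unfolding y_def
  proof (rule homeomorphic_map_extend_by_identity[OF HM U'(1)])
    have "continuous_map (subtopology (Euclidean_space n) V') (subtopology M U') \<psi>"
      using sub by (simp add: homeomorphic_maps_def)
    moreover have "compactin (subtopology (Euclidean_space n) V') C"
      using h(2,3) by (simp add: compactin_subtopology)
    ultimately have "compactin (subtopology M U') (\<psi> ` C)"
      by (rule image_compactin[rotated])
    then show "compactin M (\<psi> ` C)" "\<psi> ` C \<subseteq> U'"
      by (auto simp: compactin_subtopology)
    show "homeomorphic_maps (subtopology M U') (subtopology M U') (\<psi> \<circ> (h \<circ> \<phi>)) ((\<psi> \<circ> h') \<circ> \<phi>)"
      by (rule homeomorphic_maps_compose[OF conjI[OF
            homeomorphic_maps_compose[OF conjI[OF sub hV]] homeomorphic_maps_sym[THEN iffD1, OF sub]]])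
    show "(\<psi> \<circ> (h \<circ> \<phi>)) x = x" if x: "x \<in> U' - \<psi> ` C" for x
    proof -
      have "\<phi> x \<notin> C" using x \<psi>\<phi>[of x] by (metis DiffD1 DiffD2 imageI)
      moreover have "\<phi> x \<in> topspace (Euclidean_space n)"
        using x \<phi>UV VX U'(3) by blast
      ultimately show ?thesis using h(4) \<psi>\<phi> x by simp
    qed
  qed
  moreover have "y x = x" if "x \<in> topspace M - W" for x using that U'(4) by (auto simp: y_def)
  moreover have "\<exists>x\<in>W. y x \<noteq> x"
  proof -
    obtain z where z: "z \<in> V'" "h z \<noteq> z" using h(5) by blast
    then obtain x where x: "x \<in> U'" "z = \<phi> x" by (auto simp: V'_def)
    have "z \<in> topspace (subtopology (Euclidean_space n) V')"
      using z(1) openin_subset[OF V'] by auto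
    then have "h z \<in> topspace (subtopology (Euclidean_space n) V')"
      using hV by (auto simp: homeomorphic_maps_def continuous_map_def Pi_iff)
    then have "\<phi> (\<psi> (h z)) = h z" using sub by (simp add: homeomorphic_maps_def)
    then have "\<psi> (h z) \<noteq> x" using z(2) x(2) by auto
    then have "y x \<noteq> x" using x by (simp add: y_def)
    then show ?thesis using x(1) U'(4) by blast
  qed
  ultimately show thesis by (rule that)
qed

section \<open>Homeomorphism groups of manifolds\<close>

text \<open>The witnesses for the three conditions are points. For the transposition of \<open>p\<close> and \<open>q\<close>
  all three are \<open>p\<close>. For a homeomorphism \<open>h\<close> supported in \<open>W\<close>, a point \<open>x\<close> moved by \<open>h\<close> rules
  out the first two relations: \<open>h\<close> is the identity on \<open>f W\<close>, so \<open>f h x\<close> and \<open>h f h x\<close> agree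
  and differ from \<open>f x = h f x\<close>. The point \<open>p\<close> distinguishes the squares.\<close>

lemma Homeo_separated:
  assumes M: "topological_manifold M" and f: "f \<in> carrier (Homeo M)"
    and ff: "f \<otimes>\<^bsub>Homeo M\<^esub> f \<noteq> \<one>\<^bsub>Homeo M\<^esub>"
  shows "\<exists>y\<in>carrier (Homeo M). f \<otimes>\<^bsub>Homeo M\<^esub> y \<noteq> y \<otimes>\<^bsub>Homeo M\<^esub> f \<and>
     y \<otimes>\<^bsub>Homeo M\<^esub> (f \<otimes>\<^bsub>Homeo M\<^esub> y) \<noteq> f \<and> y \<otimes>\<^bsub>Homeo M\<^esub> y \<noteq> f \<otimes>\<^bsub>Homeo M\<^esub> f"
proof -
  let ?X = "topspace M"
  have HM: "Hausdorff_space M" using M by (simp add: topological_manifold_def)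
  have fh: "homeomorphic_map M M f" using f by (simp add: carrier_Homeo)
  have fX: "f x \<in> ?X" if "x \<in> ?X" for x
    using homeomorphic_imp_surjective_map[OF fh] that by blast
  have finj: "f x = f z \<longleftrightarrow> x = z" if "x \<in> ?X" "z \<in> ?X" for x z
    using homeomorphic_imp_injective_map[OF fh] that by (auto simp: inj_on_def)
  obtain p where p: "p \<in> ?X" "f (f p) \<noteq> p"
    using ff f by (auto simp: mult_Homeo one_Homeo compose_def fun_eq_iff split: if_splits)
  define q where "q = f p"
  define r where "r = f q"
  have qr: "q \<in> ?X" "r \<in> ?X" "f p = q" "f q = r" and ne: "p \<noteq> q" "q \<noteq> r" "p \<noteq> r"
    using p fX finj by (auto simp: q_def r_def)
  \<comment> \<open>This passes from the restricted maps that form the group to plain homeomorphisms and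
    pointwise inequalities.\<close>
  have separating: ?thesis
    if h: "homeomorphic_map M M h"
      and x: "x1 \<in> ?X" "f (h x1) \<noteq> h (f x1)"
      and x': "x2 \<in> ?X" "h (f (h x2)) \<noteq> f x2"
      and x'': "x3 \<in> ?X" "h (h x3) \<noteq> f (f x3)" for h x1 x2 x3
  proof -
    let ?y = "restrict h ?X"
    have hX: "h x \<in> ?X" if "x \<in> ?X" for x
      using homeomorphic_imp_surjective_map[OF h] that by blast
    have y: "?y \<in> carrier (Homeo M)"
      using homeomorphic_map_eq[OF h, of ?y] by (simp add: carrier_Homeo)
    have fy: "f \<otimes>\<^bsub>Homeo M\<^esub> ?y \<in> carrier (Homeo M)"
      using f y by (rule monoid.m_closed[OF group.is_monoid[OF group_Homeo]])
    have yfy: "?y \<otimes>\<^bsub>Homeo M\<^esub> (f \<otimes>\<^bsub>Homeo M\<^esub> ?y) = compose ?X ?y (compose ?X f ?y)"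
      using fy unfolding mult_Homeo[OF y fy] by (simp add: mult_Homeo[OF f y])
    have at: "(f \<otimes>\<^bsub>Homeo M\<^esub> ?y) x1 \<noteq> (?y \<otimes>\<^bsub>Homeo M\<^esub> f) x1"
      "(?y \<otimes>\<^bsub>Homeo M\<^esub> (f \<otimes>\<^bsub>Homeo M\<^esub> ?y)) x2 \<noteq> f x2"
      "(?y \<otimes>\<^bsub>Homeo M\<^esub> ?y) x3 \<noteq> (f \<otimes>\<^bsub>Homeo M\<^esub> f) x3"
      unfolding yfy unfolding mult_Homeo[OF f y] mult_Homeo[OF y f] mult_Homeo[OF y y] mult_Homeo[OF f f]
      using x x' x'' hX fX by (simp_all add: compose_def)
    show ?thesis
      by (rule bexI[OF _ y]) (use at in metis)
  qed
  show ?thesis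
  proof (cases "openin M {q}")
    case True
    have "{p} = {x \<in> ?X. f x \<in> {q}}" using p(1) finj qr by auto
    then have "openin M {p}"
      using openin_continuous_map_preimage[OF homeomorphic_imp_continuous_map[OF fh] True] by simp
    from homeomorphic_map_swap_isolated_points[OF HM this True] show ?thesis
      by (rule separating[of _ p p p]) (use p qr ne in auto)
  next
    case False
    obtain A B where AB: "openin M A" "openin M B" "q \<in> A" "r \<in> B" "disjnt A B"
      using HM qr(1,2) ne(2) unfolding Hausdorff_space_def by metis
    \<comment> \<open>Chosen so that \<open>f\<close> maps \<open>W\<close> off itself and \<open>p\<close> lies outside \<open>W\<close>.\<close>
    define W where "W = (A \<inter> {x \<in> ?X. f x \<in> B}) - {p}"
    have W: "openin M W" "q \<in> W"
    proof -
      have "openin M {x \<in> ?X. f x \<in> B}"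
        by (rule openin_continuous_map_preimage[OF homeomorphic_imp_continuous_map[OF fh] AB(2)])
      then show "openin M W"
        unfolding W_def using AB(1) HM p(1)
        by (intro openin_diff openin_Int) (auto simp: Hausdorff_imp_t1_space closedin_t1_singleton)
      show "q \<in> W" using AB qr ne by (auto simp: W_def)
    qed
    have fW: "f x \<notin> W" if "x \<in> W" for x
      using that AB(5) by (auto simp: W_def disjnt_iff)
    have WX: "x \<in> ?X" if "x \<in> W" for x using that openin_subset[OF W(1)] by blast
    obtain h where h: "homeomorphic_map M M h" "\<And>x. x \<in> ?X - W \<Longrightarrow> h x = x" "\<exists>x\<in>W. h x \<noteq> x"
      using manifold_homeomorphism_supported_near_nonisolated_point[OF M W False] by blast
    then obtain x where x: "x \<in> W" "h x \<noteq> x" by blast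
    have hx: "h x \<in> ?X"
      using homeomorphic_imp_surjective_map[OF h(1)] WX[OF x(1)] by blast
    have "h x \<in> W"
    proof (rule ccontr)
      assume "h x \<notin> W"
      with h(2) hx have "h (h x) = h x" by simp
      with homeomorphic_imp_injective_map[OF h(1)] hx WX[OF x(1)] x(2) show False
        by (auto dest: inj_onD)
    qed
    have "h (f x) = f x" "h (f (h x)) = f (h x)" "f (h x) \<noteq> f x"
      using h(2) fX fW hx WX x finj \<open>h x \<in> W\<close> by auto
    moreover have "h (h p) = p" using h(2)[of p] p(1) by (simp add: W_def)
    ultimately show ?thesis
      using x(1) WX p by (intro separating[OF h(1), of x x p]) auto
  qed
qed

theorem corollary13:
  fixes M :: "'a topology"
  assumes "topological_manifold M" and "second_countable M"
  shows "natural_group (Homeo M)"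
proof -
  have "carrier (Homeo M) \<subseteq> {f \<in> extensional (topspace M). continuous_map M M f}"
    by (auto simp: carrier_Homeo homeomorphic_imp_continuous_map)
  moreover have "\<dots> \<lesssim> (UNIV :: real set)"
    using assms by (intro continuous_maps_second_countable_Hausdorff_lepoll_real)
      (auto simp: topological_manifold_def)
  ultimately have "carrier (Homeo M) \<lesssim> (UNIV :: real set)"
    by (metis lepoll_trans subset_imp_lepoll)
  then show ?thesis
    using Homeo_separated[OF assms(1)]
    by (rule group.natural_group_if_separated[OF group_Homeo])
qed

end
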